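(* Let $(m,r)\in\mathcal R_1$ and $a>0$. Assume $(m',r')\in\mathcal R$ satisfies $0\le r'-m'<\frac{r}{1-m}$ and $r'\ge\frac{r}{1-m}$. Then there exists a (strictly) stationary INAR(1) process with parameters $(m,r)$ and with a CompNB$(m',r',a)$ marginal distribution. The innovation sequence $\{\epsilon_t\}$ has a marginal distribution that is the convolution of a CompNB$(m_1,r_1,a)$ distribution and a CompNB$(m_2,r_2,a)$ distribution, where $$(m_1,r_1)=(r,r)+(r'-m')(m-1,m)\quad\text{and}\quad(m_2,r_2)=(r'(1-m)-r,\;r').$$
   Context: $\mathcal R=\{(m,r)\in\mathbb R^2: r\ge 0,\ 0<m\le r+1\}$ and $\mathcal R_1=\{(m,r)\in\mathbb R^2: r\ge 0,\ 0<m<1\}$. For $(m,r)\in\mathcal R$, $\psi_{m,r}(s)=1-m\frac{1-s}{1+r(1-s)}$, $s\in[0,1]$ (a probability generating function, pgf). For $0<m\le r$ and $a>0$, CompNB$(m,r,a)$ is the distribution on $\mathbb Z_+$ with pgf $[\psi_{m,r}(s)]^a$; it is a compound negative binomial distribution (a random sum of iid $\mathbb Z_+$-valued random variables with an independent negative binomial number of terms). For $m=0$ the same formula gives the distribution degenerate at $0$. For $(m,r)\in\mathcal R_1$, an INAR(1) process with parameters $(m,r)$ is a sequence $(X_t,t\ge0)$ of $\mathbb Z_+$-valued random variables such that for every $t\ge1$, $$X_t=\sum_{i=1}^{X_{t-1}}Z_{i,t-1}+\epsilon_t,$$ where $(Z_{i,t})$ is an array of iid $\mathbb Z_+$-valued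 random variables with common pgf $\psi_{m,r}$, $(\epsilon_t,t\ge1)$ is an iid sequence of $\mathbb Z_+$-valued random variables (the innovation sequence), and $X_0$, $(\epsilon_t)$ and $(Z_{i,t})$ are mutually independent. *)

theory Defs
  imports "HOL-Probability.Probability"
begin

definition R_params :: "(real \<times> real) set" where
  "R_params = {(m, r). r \<ge> 0 \<and> 0 < m \<and> m \<le> r + 1}"

definition R1_params :: "(real \<times> real) set" where
  "R1_params = {(m, r). r \<ge> 0 \<and> 0 < m \<and> m < 1}"

definition psi :: "real \<Rightarrow> real \<Rightarrow> real \<Rightarrow> real" where
  "psi m r s = 1 - m * ((1 - s) / (1 + r * (1 - s)))"

definition pgf :: "nat pmf \<Rightarrow> real \<Rightarrow> real" where
  "pgf p s = measure_pmf.expectation p (\<lambda>n. s ^ n)"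

text \<open>
  A law on the naturals is determined by the values of its pgf on the unit interval, so at most one
  \<open>p\<close> satisfies \<open>CompNB m r a p\<close>. The case \<open>m = 0\<close> is the law degenerate at 0. For
  \<open>0 \<le> m \<le> r\<close> the base of \<open>powr\<close> is positive on the unit interval.
\<close>
definition CompNB :: "real \<Rightarrow> real \<Rightarrow> real \<Rightarrow> nat pmf \<Rightarrow> bool" where
  "CompNB m r a p \<longleftrightarrow>
     0 \<le> m \<and> m \<le> r \<and> 0 < a \<and> (\<forall>s\<in>{0..1}. pgf p s = psi m r s powr a)"

definition convolution_pmf :: "nat pmf \<Rightarrow> nat pmf \<Rightarrow> nat pmf" where
  "convolution_pmf p q = map_pmf (\<lambda>(x, y). x + y) (pair_pmf p q)"

definition has_law :: "'w measure \<Rightarrow> ('w \<Rightarrow> nat) \<Rightarrow> nat pmf \<Rightarrow> bool" where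
  "has_law M Y p \<longleftrightarrow>
     Y \<in> M \<rightarrow>\<^sub>M count_space UNIV \<and> distr M (count_space UNIV) Y = measure_pmf p"

definition strictly_stationary :: "'w measure \<Rightarrow> (nat \<Rightarrow> 'w \<Rightarrow> nat) \<Rightarrow> bool" where
  "strictly_stationary M X \<longleftrightarrow>
     (\<forall>t. X t \<in> M \<rightarrow>\<^sub>M count_space UNIV) \<and>
     (\<forall>J h. finite J \<longrightarrow>
        distr M (\<Pi>\<^sub>M t\<in>J. count_space UNIV) (\<lambda>\<omega>. \<lambda>t\<in>J. X (t + h) \<omega>) =
        distr M (\<Pi>\<^sub>M t\<in>J. count_space UNIV) (\<lambda>\<omega>. \<lambda>t\<in>J. X t \<omega>))"

text \<open>
  The sources of randomness of an INAR(1) process: \<open>X\<^sub>0\<close>, the innovations \<open>\<epsilon>\<^sub>t\<close> with \<open>t \<ge> 1\<close>, and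
  the summands \<open>Z\<^sub>i\<^sub>,\<^sub>t\<close> with \<open>i \<ge> 1\<close> and \<open>t \<ge> 0\<close>. Since the innovations and the array are each
  independent families, mutual independence of \<open>X\<^sub>0\<close>, the innovation sequence and the array means
  that all these variables together form one independent family.
\<close>
datatype inar_source = Init | Innov nat | Summand nat nat

definition inar_sources :: "inar_source set" where
  "inar_sources = {Init} \<union> {Innov t | t. t \<ge> 1} \<union> {Summand i t | i t. i \<ge> 1}"

primrec source_var ::
  "('w \<Rightarrow> nat) \<Rightarrow> (nat \<Rightarrow> 'w \<Rightarrow> nat) \<Rightarrow> (nat \<Rightarrow> nat \<Rightarrow> 'w \<Rightarrow> nat) \<Rightarrow> inar_source \<Rightarrow> 'w \<Rightarrow> nat"
where
  "source_var X0 \<epsilon> Z Init = X0"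
| "source_var X0 \<epsilon> Z (Innov t) = \<epsilon> t"
| "source_var X0 \<epsilon> Z (Summand i t) = Z i t"

definition inar1 ::
  "'w measure \<Rightarrow> real \<Rightarrow> real \<Rightarrow> (nat \<Rightarrow> 'w \<Rightarrow> nat) \<Rightarrow> (nat \<Rightarrow> nat \<Rightarrow> 'w \<Rightarrow> nat) \<Rightarrow>
     (nat \<Rightarrow> 'w \<Rightarrow> nat) \<Rightarrow> bool" where
  "inar1 M m r X Z \<epsilon> \<longleftrightarrow>
     prob_space M \<and> (m, r) \<in> R1_params \<and>
     (\<forall>t. X t \<in> M \<rightarrow>\<^sub>M count_space UNIV) \<and>
     (\<exists>p. (\<forall>s\<in>{0..1}. pgf p s = psi m r s) \<and> (\<forall>i\<ge>1. \<forall>t. has_law M (Z i t) p)) \<and>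
     (\<exists>q. \<forall>t\<ge>1. has_law M (\<epsilon> t) q) \<and>
     prob_space.indep_vars M (\<lambda>_. count_space UNIV) (source_var (X 0) \<epsilon> Z) inar_sources \<and>
     (\<forall>t\<ge>1. \<forall>\<omega>\<in>space M. X t \<omega> = (\<Sum>i = 1..X (t - 1) \<omega>. Z i (t - 1) \<omega>) + \<epsilon> t \<omega>)"

end

theory Submission
  imports Defs "HOL-Complex_Analysis.Complex_Analysis"
begin

text \<open>
  Let \<open>p\<close> and \<open>q\<close> be laws on the naturals. One step of the recursion, with state law \<open>p\<close> and innovation
  law \<open>q\<close>, produces a state whose pgf at \<open>s\<close> is \<open>pgf p (psi m r s) * pgf q s\<close>. Hence \<open>p\<close> is the
  marginal law of a stationary process with innovation law \<open>q\<close> if and only if the stationarity equation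
  \<open>pgf p s = pgf p (psi m r s) * pgf q s\<close> holds on \<open>{0..1}\<close>.
  
  For \<open>p\<close> the CompNB law with parameters \<open>(m', r', a)\<close> this equation can be solved explicitly. All the
  functions \<open>\<psi>\<close> are fractional linear in \<open>1 - s\<close> with value 1 at \<open>s = 1\<close>, and the quotient
  \<open>psi m' r' s / psi m' r' (psi m r s)\<close> factors into \<open>psi m\<^sub>1 r\<^sub>1 s * psi m\<^sub>2 r\<^sub>2 s\<close>
  (\<open>CompNB_stationarity_equation\<close>). The two bounds relating \<open>r' - m'\<close> and \<open>r'\<close> to \<open>r / (1 - m)\<close> ensure
  that \<open>m\<^sub>1\<close> and \<open>m\<^sub>2\<close> are nonnegative, so that the \<open>a\<close>-th powers of the factors are pgfs of CompNB laws
  (\<open>CompNB_exists\<close>), and \<open>q\<close> is their convolution.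
  
  For existence, all sources of randomness are taken as the coordinates of one infinite product
  space. The stationarity equation says that the shift of time, which replaces the initial state by the
  state at time 1, preserves the product measure (\<open>source_space_shift_invariant\<close>); strict stationarity
  of the process is then immediate. Conversely, in any stationary process with this marginal the
  innovation law satisfies the same equation; the factor \<open>pgf p (psi m r s)\<close> is positive and cancels,
  and a law is determined by its pgf (\<open>pgf_unique\<close>).
\<close>

section \<open>Probability generating functions of laws on the naturals\<close>

lemma pgf_sums:
  assumes "\<bar>s\<bar> \<le> 1"
  shows "(\<lambda>n. pmf p n * s ^ n) sums pgf p s"
proof -
  have "integrable (measure_pmf p) (\<lambda>n. s ^ n)"
    by (rule measure_pmf.integrable_const_bound[where B = 1])
       (use assms in \<open>auto simp: power_abs power_le_one\<close>)
  then have "integrable (count_space UNIV) (\<lambda>n. pmf p n * s ^ n)"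
    unfolding measure_pmf_eq_density by (subst (asm) integrable_density) auto
  then have "(\<lambda>n. pmf p n * s ^ n) sums (\<integral>n. pmf p n * s ^ n \<partial>count_space UNIV)"
    by (rule sums_integral_count_space_nat)
  also have "(\<integral>n. pmf p n * s ^ n \<partial>count_space UNIV) = pgf p s"
    unfolding pgf_def measure_pmf_eq_density by (subst integral_density) auto
  finally show ?thesis .
qed

lemma pgf_eqI:
  assumes "\<bar>s\<bar> \<le> 1" and "(\<lambda>n. pmf p n * s ^ n) sums g"
  shows "pgf p s = g"
  using sums_unique2[OF pgf_sums[OF assms(1)] assms(2)] .

text \<open>
  For \<open>s \<in> {0..1}\<close> everything is nonnegative, so pgf identities can be derived in the extended
  nonnegative reals, where no integrability has to be checked; this lemma is the bridge.
\<close>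
lemma nn_integral_power_eq_pgf:
  assumes "s \<in> {0..1}"
  shows "(\<integral>\<^sup>+n. ennreal (s ^ n) \<partial>measure_pmf p) = ennreal (pgf p s)"
proof -
  have "integrable (measure_pmf p) (\<lambda>n. s ^ n)"
    by (rule measure_pmf.integrable_const_bound[where B = 1])
       (use assms in \<open>auto simp: power_abs power_le_one\<close>)
  then show ?thesis
    unfolding pgf_def using assms by (intro nn_integral_eq_integral) auto
qed

lemma pgf_nonneg: "s \<in> {0..1} \<Longrightarrow> 0 \<le> pgf p s"
  unfolding pgf_def by (intro integral_nonneg_AE) auto

lemma pgf_le_1:
  assumes "s \<in> {0..1}"
  shows "pgf p s \<le> 1"
proof -
  have "(\<integral>\<^sup>+n. ennreal (s ^ n) \<partial>measure_pmf p) \<le> (\<integral>\<^sup>+n. 1 \<partial>measure_pmf p)"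
    using assms by (intro nn_integral_mono) (auto intro: power_le_one)
  then show ?thesis
    using assms by (simp add: nn_integral_power_eq_pgf ennreal_le_1)
qed

text \<open>
  The difference of the two pgfs is a power series that vanishes on \<open>{0..1}\<close>. If some coefficient
  were nonzero, its zero at the origin would be isolated, but the points of \<open>{0..1}\<close> accumulate
  there.
\<close>
lemma pgf_unique:
  assumes eq: "\<And>s. s \<in> {0..1} \<Longrightarrow> pgf p s = pgf q s"
  shows "p = q"
proof (rule pmf_eqI)
  fix k
  define c where "c n = pmf p n - pmf q n" for n
  have sums: "(\<lambda>n. c n * x ^ n) sums (pgf p x - pgf q x)" if "\<bar>x\<bar> \<le> 1" for x
    using sums_diff[OF pgf_sums[OF that] pgf_sums[OF that]] by (simp add: c_def algebra_simps)
  have c0: "c 0 = 0"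
    using sums[of 0] eq[of 0] by simp
  have "c k = 0"
  proof (rule ccontr)
    assume ck: "c k \<noteq> 0"
    have "k > 0" using ck c0 by (cases k) auto
    obtain \<delta> where "0 < \<delta>" and \<delta>: "\<And>z. z \<in> cball 0 \<delta> - {0} \<Longrightarrow> pgf p z - pgf q z \<noteq> 0"
    proof (rule powser_0_nonzero[of 1 0 c "\<lambda>x. pgf p x - pgf q x" k])
      show "(\<lambda>n. c n * (x - 0) ^ n) sums (pgf p x - pgf q x)" if "norm (x - 0) < 1" for x
        using sums[of x] that by simp
    qed (use eq[of 0] ck \<open>k > 0\<close> in auto)
    then show False
      using \<delta>[of "min \<delta> 1"] eq[of "min \<delta> 1"] by auto
  qed
  then show "pmf p k = pmf q k" by (simp add: c_def)
qed

lemma pgf_convolution: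
  assumes s: "s \<in> {0..1}"
  shows "pgf (convolution_pmf p q) s = pgf p s * pgf q s"
proof -
  have "ennreal (pgf (convolution_pmf p q) s)
      = (\<integral>\<^sup>+x. \<integral>\<^sup>+y. ennreal (s ^ x) * ennreal (s ^ y) \<partial>measure_pmf q \<partial>measure_pmf p)"
    using s by (simp add: nn_integral_power_eq_pgf[symmetric] convolution_pmf_def nn_integral_pair_pmf'
        power_add ennreal_mult')
  also have "\<dots> = ennreal (pgf p s * pgf q s)"
    using s by (simp add: nn_integral_cmult nn_integral_multc nn_integral_power_eq_pgf pgf_nonneg
        ennreal_mult)
  finally show ?thesis
    using s by (simp add: pgf_nonneg)
qed

primrec iid_sum_pmf :: "nat pmf \<Rightarrow> nat \<Rightarrow> nat pmf" where
  "iid_sum_pmf p 0 = return_pmf 0"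
| "iid_sum_pmf p (Suc n) = convolution_pmf p (iid_sum_pmf p n)"

lemma pgf_iid_sum: "s \<in> {0..1} \<Longrightarrow> pgf (iid_sum_pmf p n) s = pgf p s ^ n"
proof (induction n)
  case 0
  then show ?case by (simp add: pgf_def)
next
  case (Suc n)
  then show ?case by (simp add: pgf_convolution)
qed

text \<open>
  Conditionally on the number of terms being \<open>n\<close>, the sum has pgf \<open>pgf q s ^ n\<close>; averaging over
  \<open>n\<close> evaluates the pgf of the number of terms at \<open>pgf q s\<close>.
\<close>
lemma pgf_random_sum:
  assumes s: "s \<in> {0..1}"
  shows "pgf (bind_pmf p (iid_sum_pmf q)) s = pgf p (pgf q s)"
proof -
  have q: "pgf q s \<in> {0..1}"
    using pgf_nonneg[OF s] pgf_le_1[OF s] by simp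
  have "ennreal (pgf (bind_pmf p (iid_sum_pmf q)) s) = ennreal (pgf p (pgf q s))"
    using s q by (simp add: nn_integral_power_eq_pgf[symmetric] pgf_iid_sum[symmetric])
  then show ?thesis
    using s q by (simp add: pgf_nonneg)
qed

section \<open>The families \<open>\<psi>\<close> and CompNB\<close>

lemma psi_eq_fraction:
  assumes "r \<ge> 0" and "s \<le> 1"
  shows "psi m r s = (1 + (r - m) * (1 - s)) / (1 + r * (1 - s))"
proof -
  have "1 + r * (1 - s) > 0"
    using assms by (intro add_pos_nonneg mult_nonneg_nonneg) auto
  then show ?thesis
    by (simp add: psi_def field_simps)
qed

lemma psi_pos:
  assumes "m \<le> r" "0 \<le> r" "s \<le> 1"
  shows "psi m r s > 0"
proof -
  have "1 + r * (1 - s) > 0" "1 + (r - m) * (1 - s) > 0"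
    using assms by (auto intro!: add_pos_nonneg mult_nonneg_nonneg)
  then show ?thesis
    using assms by (simp add: psi_eq_fraction)
qed

text \<open>
  \<open>psi m r\<close> is the pgf of a mixture of the unit mass at 0 and, with weight \<open>m / (1 + r)\<close>, a
  geometric law with success probability \<open>1 / (1 + r)\<close> shifted to start at 1. The weight is at most 1
  exactly when \<open>m \<le> r + 1\<close>.
\<close>
lemma psi_is_pgf:
  assumes "(m, r) \<in> R_params"
  obtains p where "\<And>s. s \<in> {0..1} \<Longrightarrow> pgf p s = psi m r s"
proof -
  have mr: "0 \<le> r" "0 < m" "m \<le> r + 1"
    using assms by (auto simp: R_params_def)
  define \<beta> where "\<beta> = 1 / (1 + r)"
  define b where "b = m / (1 + r)"
  have \<beta>: "0 < \<beta>" "\<beta> \<le> 1" and b: "0 \<le> b" "b \<le> 1"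
    using mr by (auto simp: \<beta>_def b_def)
  define p where "p = bernoulli_pmf b \<bind>
    (\<lambda>c. if c then map_pmf Suc (geometric_pmf \<beta>) else return_pmf 0)"
  have geo: "pgf (geometric_pmf \<beta>) s = \<beta> / (1 - (1 - \<beta>) * s)" if s: "s \<in> {0..1}" for s
  proof (rule pgf_eqI)
    have "(1 - \<beta>) * s \<le> (1 - \<beta>) * 1"
      using s \<beta> by (intro mult_left_mono) auto
    then have "norm ((1 - \<beta>) * s) < 1"
      using s \<beta> by (auto simp: abs_mult)
    from sums_mult[OF geometric_sums[OF this], of \<beta>]
    show "(\<lambda>n. pmf (geometric_pmf \<beta>) n * s ^ n) sums (\<beta> / (1 - (1 - \<beta>) * s))"
      using \<beta> by (simp add: power_mult_distrib mult_ac)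
  qed (use s in auto)
  have "pgf p s = psi m r s" if s: "s \<in> {0..1}" for s
  proof -
    have "ennreal (pgf p s) = (\<integral>\<^sup>+n. ennreal (s ^ n) \<partial>measure_pmf p)"
      using s by (simp add: nn_integral_power_eq_pgf)
    also have "\<dots> = ennreal b * (\<integral>\<^sup>+n. ennreal s * ennreal (s ^ n) \<partial>geometric_pmf \<beta>) + ennreal (1 - b)"
      using s b by (simp add: p_def ennreal_mult' mult.commute)
    also have "\<dots> = ennreal b * (ennreal s * ennreal (pgf (geometric_pmf \<beta>) s)) + ennreal (1 - b)"
      using s by (simp add: nn_integral_cmult nn_integral_power_eq_pgf)
    also have "\<dots> = ennreal (b * (s * pgf (geometric_pmf \<beta>) s) + (1 - b))"
      using s b by (simp add: ennreal_mult pgf_nonneg)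
    finally have "pgf p s = b * (s * pgf (geometric_pmf \<beta>) s) + (1 - b)"
      using s b by (subst (asm) ennreal_inj) (auto simp: pgf_nonneg)
    moreover have D: "1 + r * (1 - s) > 0"
      using mr s by (intro add_pos_nonneg mult_nonneg_nonneg) auto
    moreover have "1 - (1 - \<beta>) * s = (1 + r * (1 - s)) / (1 + r)"
      using mr by (simp add: \<beta>_def field_simps)
    then have "pgf (geometric_pmf \<beta>) s = 1 / (1 + r * (1 - s))"
      using mr s D by (simp add: geo) (simp add: \<beta>_def)
    moreover have "b * (1 + r * (1 - s) - s) = m * (1 - s)"
      using mr by (simp add: b_def field_simps)
    ultimately show ?thesis
      by (simp add: psi_def field_simps)
  qed
  then show ?thesis using that by blast
qed

text \<open>
  The negative binomial law with real shape parameter \<open>a\<close>. Its pgf is expanded by the binomial series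
  with exponent \<open>- a\<close>; the signs of the generalized binomial coefficients and of the argument cancel,
  so the coefficients are nonnegative, and their sum is the value \<open>1\<close> of the function at \<open>s = 1\<close>.
\<close>
lemma negative_binomial_pgf:
  fixes a q :: real
  assumes a: "a > 0" and q: "0 < q" "q \<le> 1"
  obtains p where "\<And>s. s \<in> {0..1} \<Longrightarrow> pgf p s = (q / (1 - (1 - q) * s)) powr a"
proof -
  \<comment> \<open>The form suited to the binomial series; the next fact gives the form that shows the sign.\<close>
  define f where "f n = q powr a * ((-a gchoose n) * (- (1 - q)) ^ n)" for n
  have f: "f n = q powr a * (pochhammer a n / fact n * (1 - q) ^ n)" for n
    by (simp add: f_def gbinomial_pochhammer power_mult_distrib[symmetric])
  have nonneg: "f n \<ge> 0" for n
    unfolding f using a q by (intro mult_nonneg_nonneg divide_nonneg_nonneg pochhammer_nonneg) auto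
  have sums: "(\<lambda>n. f n * s ^ n) sums ((q / (1 - (1 - q) * s)) powr a)" if s: "s \<in> {0..1}" for s
  proof -
    have "(1 - q) * s \<le> (1 - q) * 1"
      using s q by (intro mult_left_mono) auto
    then have lt: "(1 - q) * s < 1" using q by simp
    have "\<bar>- ((1 - q) * s)\<bar> < 1"
      using s q lt by (simp add: abs_mult)
    from sums_mult[OF gen_binomial_real[OF this, of "- a"], of "q powr a"]
    have "(\<lambda>n. f n * s ^ n) sums (q powr a * (1 - (1 - q) * s) powr - a)"
      by (simp add: f_def power_mult_distrib[symmetric] mult.assoc del: minus_diff_eq)
    also have "q powr a * (1 - (1 - q) * s) powr - a = (q / (1 - (1 - q) * s)) powr a"
      using q lt by (simp add: powr_divide powr_minus_divide)
    finally show ?thesis .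
  qed
  have total: "(\<integral>\<^sup>+n. ennreal (f n) \<partial>count_space UNIV) = 1"
  proof -
    have "f sums 1" using sums[of 1] q by simp
    then show ?thesis
      using suminf_ennreal_eq[OF nonneg] by (simp only: nn_integral_count_space_nat ennreal_1)
  qed
  have "pgf (embed_pmf f) s = (q / (1 - (1 - q) * s)) powr a" if "s \<in> {0..1}" for s
    using that by (intro pgf_eqI) (auto simp: pmf_embed_pmf[OF nonneg total] sums)
  then show ?thesis using that by blast
qed

text \<open>
  Since \<open>1 / psi m r s = 1 + m - m * psi 1 (r - m) s\<close>, putting \<open>q = 1 / (1 + m)\<close> gives
  \<open>psi m r s = q / (1 - (1 - q) * psi 1 (r - m) s)\<close>. Its \<open>a\<close>-th power is a negative binomial pgf
  composed with the pgf \<open>psi 1 (r - m)\<close>, that is, the pgf of a random sum. The hypothesis \<open>m \<le> r\<close> puts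
  \<open>(1, r - m)\<close> into the parameter set of \<open>\<psi>\<close>.
\<close>
lemma CompNB_exists:
  assumes m: "0 \<le> m" "m \<le> r" and a: "a > 0"
  obtains p where "CompNB m r a p"
proof -
  obtain N where N: "\<And>s. s \<in> {0..1} \<Longrightarrow>
      pgf N s = (1 / (1 + m) / (1 - (1 - 1 / (1 + m)) * s)) powr a"
    using negative_binomial_pgf[of a "1 / (1 + m)"] m a by auto
  have "(1, r - m) \<in> R_params"
    using m by (simp add: R_params_def)
  then obtain g where g: "\<And>s. s \<in> {0..1} \<Longrightarrow> pgf g s = psi 1 (r - m) s"
    using psi_is_pgf by blast
  have "pgf (bind_pmf N (iid_sum_pmf g)) s = psi m r s powr a" if s: "s \<in> {0..1}" for s
  proof -
    define u where "u = 1 - s"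
    have u: "0 \<le> u" using s by (simp add: u_def)
    have pos: "1 + (r - m) * u > 0" "1 + r * u > 0"
      using m u by (auto intro!: add_pos_nonneg mult_nonneg_nonneg)
    have "pgf g s \<in> {0..1}"
      using pgf_nonneg[OF s] pgf_le_1[OF s] by simp
    then have "pgf (bind_pmf N (iid_sum_pmf g)) s
        = (1 / (1 + m) / (1 - (1 - 1 / (1 + m)) * psi 1 (r - m) s)) powr a"
      using s N g[OF s] by (simp add: pgf_random_sum)
    also have "1 - (1 - 1 / (1 + m)) * psi 1 (r - m) s
        = (1 + r * u) / ((1 + m) * (1 + (r - m) * u))"
      using m pos by (simp add: psi_def u_def[symmetric] divide_simps) (simp add: algebra_simps)
    also have "1 / (1 + m) / \<dots> = psi m r s"
      using m pos s by (simp add: psi_eq_fraction u_def[symmetric])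
    finally show ?thesis .
  qed
  then show ?thesis
    using m a that[of "bind_pmf N (iid_sum_pmf g)"] by (auto simp: CompNB_def)
qed

section \<open>One step of the recursion\<close>

lemma nn_integral_has_law:
  assumes "has_law M Y p"
  shows "(\<integral>\<^sup>+\<omega>. f (Y \<omega>) \<partial>M) = (\<integral>\<^sup>+n. f n \<partial>measure_pmf p)"
proof -
  have Y: "Y \<in> M \<rightarrow>\<^sub>M count_space UNIV" and d: "distr M (count_space UNIV) Y = measure_pmf p"
    using assms by (auto simp: has_law_def)
  show ?thesis
    unfolding d[symmetric] by (rule nn_integral_distr[symmetric, OF Y]) simp
qed

text \<open>
  A law on a countable discrete space is concentrated on its atoms.
\<close>
lemma has_law_distr:
  assumes "prob_space M" and "Y \<in> M \<rightarrow>\<^sub>M count_space UNIV"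
  obtains p where "has_law M Y p"
proof -
  interpret prob_space "distr M (count_space UNIV) Y"
    using assms by (rule prob_space.prob_space_distr)
  have "AE x in distr M (count_space UNIV) Y. measure (distr M (count_space UNIV) Y) {x} \<noteq> 0"
    by (subst AE_support_countable) (auto intro!: exI[of _ UNIV])
  then have "distr M (count_space UNIV) Y = measure_pmf (Abs_pmf (distr M (count_space UNIV) Y))"
    by (subst Abs_pmf_inverse) (auto intro: prob_space_axioms)
  then show ?thesis
    using assms(2) that by (auto simp: has_law_def)
qed

text \<open>
  The integrand is split along the events \<open>W Init = n\<close>. On each of them the sum has a fixed number of
  terms, so the integrand is a product over finitely many sources and independence factorizes its
  integral.
\<close>
lemma nn_integral_inar_step:
  fixes W :: "inar_source \<Rightarrow> 'w \<Rightarrow> nat" and \<phi> :: "nat \<Rightarrow> ennreal"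
  assumes "prob_space M"
    and ind: "prob_space.indep_vars M (\<lambda>_. count_space UNIV) W inar_sources"
    and init: "has_law M (W Init) p"
    and innov: "has_law M (W (Innov 1)) q"
    and summand: "\<And>i. 1 \<le> i \<Longrightarrow> has_law M (W (Summand i 0)) z"
    and s: "s \<in> {0..1}"
  shows "(\<integral>\<^sup>+\<omega>. ennreal (s ^ ((\<Sum>i = 1..W Init \<omega>. W (Summand i 0) \<omega>) + W (Innov 1) \<omega>)) \<partial>M)
    = (\<integral>\<^sup>+n. (\<integral>\<^sup>+k. ennreal (s ^ k) \<partial>measure_pmf z) ^ n \<partial>measure_pmf p)
      * (\<integral>\<^sup>+k. ennreal (s ^ k) \<partial>measure_pmf q)"
    (is "?L = (\<integral>\<^sup>+n. ?G ^ n \<partial>_) * ?Q")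
proof -
  interpret prob_space M by fact
  have meas [measurable]: "W j \<in> M \<rightarrow>\<^sub>M count_space UNIV" if "j \<in> inar_sources" for j
    using ind that by (auto simp: indep_vars_def)
  \<comment> \<open>The factor contributed by source \<open>j\<close> on the event \<open>W Init = n\<close>; \<open>J n\<close> are the sources involved there.\<close>
  define h where "h n j k = (case j of Init \<Rightarrow> indicator {n} k | _ \<Rightarrow> ennreal (s ^ k))"
    for n :: nat and j and k :: nat
  define J where "J n = {Init, Innov 1} \<union> (\<lambda>i. Summand i 0) ` {1..n}" for n :: nat
  have J: "J n \<subseteq> inar_sources" "finite (J n)" for n
    by (auto simp: J_def inar_sources_def)
  have prod_J: "(\<Prod>j\<in>J n. g j) = g Init * g (Innov 1) * (\<Prod>i=1..n. g (Summand i 0))"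
    for g :: "inar_source \<Rightarrow> ennreal" and n
    unfolding J_def
    by (subst prod.union_disjoint) (auto simp: prod.reindex inj_on_def)
  have "?L = (\<integral>\<^sup>+\<omega>. (\<Sum>n. \<Prod>j\<in>J n. h n j (W j \<omega>)) \<partial>M)"
  proof (rule nn_integral_cong)
    fix \<omega>
    have "(\<Sum>n. \<Prod>j\<in>J n. h n j (W j \<omega>)) = (\<Sum>n. if n = W Init \<omega> then
        ennreal (s ^ W (Innov 1) \<omega>) * (\<Prod>i=1..n. ennreal (s ^ W (Summand i 0) \<omega>)) else 0)"
      unfolding prod_J by (intro suminf_cong) (auto simp: h_def)
    also have "\<dots> = ennreal (s ^ W (Innov 1) \<omega>) * (\<Prod>i=1..W Init \<omega>. ennreal (s ^ W (Summand i 0) \<omega>))"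
      by (rule sums_unique[symmetric, OF sums_single])
    also have "\<dots> = ennreal (s ^ ((\<Sum>i = 1..W Init \<omega>. W (Summand i 0) \<omega>) + W (Innov 1) \<omega>))"
      using s by (simp add: prod_ennreal power_sum power_add ennreal_mult prod_nonneg mult.commute)
    finally show "ennreal (s ^ ((\<Sum>i = 1..W Init \<omega>. W (Summand i 0) \<omega>) + W (Innov 1) \<omega>))
      = (\<Sum>n. \<Prod>j\<in>J n. h n j (W j \<omega>))" ..
  qed
  also have "\<dots> = (\<Sum>n. \<integral>\<^sup>+\<omega>. (\<Prod>j\<in>J n. h n j (W j \<omega>)) \<partial>M)"
  proof (rule nn_integral_suminf)
    fix n
    show "(\<lambda>\<omega>. \<Prod>j\<in>J n. h n j (W j \<omega>)) \<in> borel_measurable M"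
    proof (rule borel_measurable_prod_ennreal)
      fix j assume "j \<in> J n"
      then have "W j \<in> M \<rightarrow>\<^sub>M count_space UNIV" using J meas by blast
      then show "(\<lambda>\<omega>. h n j (W j \<omega>)) \<in> borel_measurable M"
        by (rule measurable_compose) simp
    qed
  qed
  also have "\<dots> = (\<Sum>n. ennreal (pmf p n) * ?G ^ n * ?Q)"
  proof (rule suminf_cong)
    fix n
    have "indep_vars (\<lambda>_. borel) (\<lambda>j \<omega>. h n j (W j \<omega>)) (J n)"
      using indep_vars_subset[OF ind J(1)] by (rule indep_vars_compose2) simp
    from indep_vars_nn_integral[OF J(2) this]
    have "(\<integral>\<^sup>+\<omega>. (\<Prod>j\<in>J n. h n j (W j \<omega>)) \<partial>M) = (\<Prod>j\<in>J n. \<integral>\<^sup>+\<omega>. h n j (W j \<omega>) \<partial>M)"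
      by simp
    also have "\<dots> = ennreal (pmf p n) * ?Q * (\<Prod>i=1..n. ?G)"
      unfolding prod_J
    proof (intro arg_cong2[where f = "(*)"] prod.cong refl)
      show "(\<integral>\<^sup>+\<omega>. h n Init (W Init \<omega>) \<partial>M) = ennreal (pmf p n)"
        by (subst nn_integral_has_law[OF init, of "h n Init"]) (simp add: h_def[abs_def] emeasure_pmf_single)
      show "(\<integral>\<^sup>+\<omega>. h n (Innov 1) (W (Innov 1) \<omega>) \<partial>M) = ?Q"
        by (subst nn_integral_has_law[OF innov, of "h n (Innov 1)"]) (simp add: h_def[abs_def])
      show "(\<integral>\<^sup>+\<omega>. h n (Summand i 0) (W (Summand i 0) \<omega>) \<partial>M) = ?G" if "i \<in> {1..n}" for i
        using that by (subst nn_integral_has_law[OF summand, of i "h n (Summand i 0)"]) (auto simp: h_def[abs_def])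
    qed
    finally show "(\<integral>\<^sup>+\<omega>. (\<Prod>j\<in>J n. h n j (W j \<omega>)) \<partial>M) = ennreal (pmf p n) * ?G ^ n * ?Q"
      by (simp add: mult_ac)
  qed
  also have "\<dots> = (\<integral>\<^sup>+n. ?G ^ n \<partial>measure_pmf p) * ?Q"
    by (simp add: nn_integral_measure_pmf nn_integral_count_space_nat)
  finally show ?thesis .
qed

lemma pgf_inar_step:
  fixes W :: "inar_source \<Rightarrow> 'w \<Rightarrow> nat"
  assumes "prob_space M"
    and "prob_space.indep_vars M (\<lambda>_. count_space UNIV) W inar_sources"
    and "has_law M (W Init) p"
    and "has_law M (W (Innov 1)) q"
    and "\<And>i. 1 \<le> i \<Longrightarrow> has_law M (W (Summand i 0)) z"
    and Y: "has_law M Y y"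
    and step: "\<And>\<omega>. \<omega> \<in> space M \<Longrightarrow>
      Y \<omega> = (\<Sum>i = 1..W Init \<omega>. W (Summand i 0) \<omega>) + W (Innov 1) \<omega>"
    and s: "s \<in> {0..1}"
  shows "pgf y s = pgf p (pgf z s) * pgf q s"
proof -
  have z: "pgf z s \<in> {0..1}"
    using pgf_nonneg[OF s] pgf_le_1[OF s] by simp
  have "ennreal (pgf y s) = (\<integral>\<^sup>+\<omega>. ennreal (s ^ Y \<omega>) \<partial>M)"
    using s by (simp add: nn_integral_has_law[OF Y, of "\<lambda>k. ennreal (s ^ k)"] nn_integral_power_eq_pgf)
  also have "\<dots> = (\<integral>\<^sup>+\<omega>. ennreal (s ^ ((\<Sum>i = 1..W Init \<omega>. W (Summand i 0) \<omega>) + W (Innov 1) \<omega>)) \<partial>M)"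
    by (intro nn_integral_cong) (simp add: step)
  also have "\<dots> = (\<integral>\<^sup>+n. ennreal (pgf z s) ^ n \<partial>measure_pmf p) * ennreal (pgf q s)"
    using nn_integral_inar_step[OF assms(1-5) s] s by (simp add: nn_integral_power_eq_pgf)
  also have "\<dots> = ennreal (pgf p (pgf z s) * pgf q s)"
    using s z by (simp add: nn_integral_power_eq_pgf ennreal_power ennreal_mult pgf_nonneg)
  finally show ?thesis
    using s z by (simp add: pgf_nonneg)
qed

section \<open>A stationary process on a product space\<close>

primrec source_law :: "nat pmf \<Rightarrow> nat pmf \<Rightarrow> nat pmf \<Rightarrow> inar_source \<Rightarrow> nat pmf" where
  "source_law p q z Init = p"
| "source_law p q z (Innov t) = q"
| "source_law p q z (Summand i t) = z"

abbreviation source_space :: "nat pmf \<Rightarrow> nat pmf \<Rightarrow> nat pmf \<Rightarrow> (inar_source \<Rightarrow> nat) measure" where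
  "source_space p q z \<equiv> PiM UNIV (\<lambda>j. measure_pmf (source_law p q z j))"

text \<open>
  The state at time 1, as a function of all sources of randomness.
\<close>
definition inar_next :: "(inar_source \<Rightarrow> nat) \<Rightarrow> nat" where
  "inar_next \<omega> = (\<Sum>i = 1..\<omega> Init. \<omega> (Summand i 0)) + \<omega> (Innov 1)"

text \<open>
  Moving the origin of time by one step: the state at time 1 becomes the initial state, and all later
  sources are renumbered. Only the innovations with index at least 1 drive the recursion, and
  \<open>Innov 1\<close> is used up in the new initial state. The coordinate \<open>Innov 0\<close> is therefore kept in
  place: giving it the value of \<open>Innov 1\<close> would in general make it dependent on the new \<open>Init\<close>.
\<close>
primrec inar_shift :: "(inar_source \<Rightarrow> nat) \<Rightarrow> inar_source \<Rightarrow> nat" where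
  "inar_shift \<omega> Init = inar_next \<omega>"
| "inar_shift \<omega> (Innov t) = \<omega> (Innov (if t = 0 then 0 else Suc t))"
| "inar_shift \<omega> (Summand i t) = \<omega> (Summand i (Suc t))"

text \<open>
  With the process defined as the initial state after \<open>t\<close> shifts, its stationarity is the invariance of
  the product measure under the shift, and the recursion is read off the new initial state.
\<close>
definition inar_path :: "nat \<Rightarrow> (inar_source \<Rightarrow> nat) \<Rightarrow> nat" where
  "inar_path t \<omega> = (inar_shift ^^ t) \<omega> Init"

lemma prob_space_source: "prob_space (source_space p q z)"
  by (intro prob_space_PiM prob_space_measure_pmf)

lemma space_source [simp]: "space (source_space p q z) = UNIV"
  by (simp add: space_PiM)

lemma has_law_source: "has_law (source_space p q z) (\<lambda>\<omega>. \<omega> j) (source_law p q z j)"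
proof -
  have "distr (source_space p q z) (count_space UNIV) (\<lambda>\<omega>. \<omega> j)
      = distr (source_space p q z) (measure_pmf (source_law p q z j)) (\<lambda>\<omega>. \<omega> j)"
    by (rule distr_cong) simp_all
  also have "\<dots> = measure_pmf (source_law p q z j)"
    by (rule distr_PiM_component) (simp_all add: prob_space_measure_pmf)
  moreover have "(\<lambda>\<omega>. \<omega> j) \<in> source_space p q z \<rightarrow>\<^sub>M measure_pmf (source_law p q z j)"
    by (rule measurable_component_singleton) simp
  ultimately show ?thesis
    by (simp add: has_law_def)
qed

lemma sets_source: "sets (source_space p q z) = sets (PiM UNIV (\<lambda>_. count_space UNIV))"
  by (rule sets_PiM_cong) auto

lemma indep_vars_source:
  "prob_space.indep_vars (source_space p q z) (\<lambda>_. count_space UNIV) (\<lambda>j \<omega>. \<omega> j) UNIV"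
proof -
  interpret prob_space "source_space p q z" by (rule prob_space_source)
  show ?thesis
    using has_law_source[of p q z]
    by (subst indep_vars_iff_distr_eq_PiM')
       (auto simp: has_law_def restrict_UNIV intro!: distr_id2 sets_source[symmetric])
qed

lemma inar_next_cong:
  assumes "\<omega> Init = \<omega>' Init" "\<omega> (Innov 1) = \<omega>' (Innov 1)" "\<And>i. \<omega> (Summand i 0) = \<omega>' (Summand i 0)"
  shows "inar_next \<omega> = inar_next \<omega>'"
  using assms by (simp add: inar_next_def)

lemma measurable_nat_add:
  assumes "f \<in> M \<rightarrow>\<^sub>M count_space UNIV" and "g \<in> M \<rightarrow>\<^sub>M count_space UNIV"
  shows "(\<lambda>\<omega>. f \<omega> + g \<omega> :: nat) \<in> M \<rightarrow>\<^sub>M count_space UNIV"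
proof (rule measurable_compose_countable[OF _ assms(1)])
  show "(\<lambda>\<omega>. k + g \<omega>) \<in> M \<rightarrow>\<^sub>M count_space UNIV" for k
    using assms(2) by (rule measurable_compose) simp
qed

text \<open>
  Stated for an arbitrary set of coordinates that contains those on which \<open>inar_next\<close> depends, because
  independence of blocks of coordinates is expressed on the restricted product spaces.
\<close>
lemma measurable_inar_next:
  assumes "insert Init (insert (Innov 1) (range (\<lambda>i. Summand i 0))) \<subseteq> K"
  shows "inar_next \<in> PiM K (\<lambda>_. count_space UNIV) \<rightarrow>\<^sub>M count_space UNIV"
proof -
  have coord: "(\<lambda>\<omega>. \<omega> j) \<in> PiM K (\<lambda>_. count_space UNIV) \<rightarrow>\<^sub>M count_space (UNIV :: nat set)"
    if "j \<in> {Init, Innov 1} \<union> range (\<lambda>i. Summand i 0)" for j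
    using assms that by (intro measurable_component_singleton) auto
  have "(\<lambda>\<omega>. \<Sum>i = 1..n. \<omega> (Summand i 0))
      \<in> PiM K (\<lambda>_. count_space UNIV) \<rightarrow>\<^sub>M count_space (UNIV :: nat set)" for n :: nat
    by (induction n) (auto intro!: measurable_nat_add coord)
  then have "(\<lambda>\<omega>. \<Sum>i = 1..\<omega> Init. \<omega> (Summand i 0)) \<in> PiM K (\<lambda>_. count_space UNIV) \<rightarrow>\<^sub>M count_space (UNIV :: nat set)"
    by (rule measurable_compose_countable) (simp add: coord)
  then show ?thesis
    unfolding inar_next_def[abs_def] by (rule measurable_nat_add) (rule coord, simp)
qed

lemma measurable_inar_shift:
  "inar_shift \<in> source_space p q z \<rightarrow>\<^sub>M source_space p q z"
proof -
  have "(\<lambda>\<omega>. inar_shift \<omega> j) \<in> PiM UNIV (\<lambda>_. count_space UNIV) \<rightarrow>\<^sub>M count_space UNIV" for j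
    by (cases j) (auto intro!: measurable_inar_next measurable_component_singleton)
  then have "(\<lambda>\<omega>. \<lambda>j\<in>UNIV. inar_shift \<omega> j) \<in> PiM UNIV (\<lambda>_. count_space UNIV) \<rightarrow>\<^sub>M PiM UNIV (\<lambda>_. count_space UNIV)"
    by (rule measurable_restrict)
  then show ?thesis
    by (simp add: restrict_UNIV cong: measurable_cong_sets[OF sets_source sets_source])
qed

text \<open>
  The coordinates of the shifted configuration depend on disjoint blocks of the old ones, hence are
  again independent. So the image measure is a product measure, and it remains to compare
  the marginals. Only the one at \<open>Init\<close> is not immediate: its pgf is computed by the one-step formula
  and equals that of \<open>p\<close> by the hypothesis.
\<close>
lemma source_space_shift_invariant:
  assumes inv: "\<And>s. s \<in> {0..1} \<Longrightarrow> pgf p s = pgf p (pgf z s) * pgf q s"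
  shows "distr (source_space p q z) (source_space p q z) inar_shift = source_space p q z"
proof -
  let ?M = "source_space p q z"
  interpret prob_space ?M by (rule prob_space_source)
  \<comment> \<open>\<open>K j\<close> are the old coordinates that determine coordinate \<open>j\<close> after the shift.\<close>
  define K where "K j = (case j of
      Init \<Rightarrow> insert Init (insert (Innov 1) (range (\<lambda>i. Summand i 0)))
    | Innov t \<Rightarrow> {Innov (if t = 0 then 0 else Suc t)}
    | Summand i t \<Rightarrow> {Summand i (Suc t)})" for j
  define h :: "inar_source \<Rightarrow> (inar_source \<Rightarrow> nat) \<Rightarrow> nat" where
    "h j f = inar_shift f j" for j f
  have "disjoint_family_on K UNIV"
    by (auto simp: disjoint_family_on_def K_def split: inar_source.splits if_splits)
  then have "indep_vars (\<lambda>j. PiM (K j) (\<lambda>_. count_space UNIV)) (\<lambda>j \<omega>. restrict \<omega> (K j)) UNIV"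
    using indep_vars_restrict[OF indep_vars_source, of UNIV K] by simp
  then have "indep_vars (\<lambda>_. count_space UNIV) (\<lambda>j \<omega>. h j (restrict \<omega> (K j))) UNIV"
  proof (rule indep_vars_compose2)
    fix j
    show "h j \<in> PiM (K j) (\<lambda>_. count_space UNIV) \<rightarrow>\<^sub>M count_space UNIV"
      by (cases j) (auto simp: h_def[abs_def] K_def intro!: measurable_inar_next measurable_component_singleton)
  qed
  also have "(\<lambda>j \<omega>. h j (restrict \<omega> (K j))) = (\<lambda>j \<omega>. inar_shift \<omega> j)"
  proof (intro ext)
    fix j \<omega>
    show "h j (restrict \<omega> (K j)) = inar_shift \<omega> j"
      by (cases j) (auto simp: h_def K_def intro!: inar_next_cong)
  qed
  finally have ind: "indep_vars (\<lambda>_. count_space UNIV) (\<lambda>j \<omega>. inar_shift \<omega> j) UNIV" .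

  have next_meas: "inar_next \<in> ?M \<rightarrow>\<^sub>M count_space UNIV"
    using measurable_inar_next[of UNIV] by (simp cong: measurable_cong_sets[OF sets_source refl])
  obtain y where y: "has_law ?M inar_next y"
    using has_law_distr[OF prob_space_source next_meas] .
  have "pgf y s = pgf p s" if s: "s \<in> {0..1}" for s
  proof -
    have "pgf y s = pgf p (pgf z s) * pgf q s"
    proof (rule pgf_inar_step[OF prob_space_source _ _ _ _ y _ s])
      show "indep_vars (\<lambda>_. count_space UNIV) (\<lambda>j \<omega>. \<omega> j) inar_sources"
        by (rule indep_vars_subset[OF indep_vars_source subset_UNIV])
      show "has_law ?M (\<lambda>\<omega>. \<omega> Init) p"
        using has_law_source[of p q z Init] by (simp only: source_law.simps)
      show "has_law ?M (\<lambda>\<omega>. \<omega> (Innov 1)) q"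
        using has_law_source[of p q z "Innov 1"] by (simp only: source_law.simps)
      show "has_law ?M (\<lambda>\<omega>. \<omega> (Summand i 0)) z" for i
        using has_law_source[of p q z "Summand i 0"] by (simp only: source_law.simps)
    qed (rule inar_next_def)
    with inv[OF s] show ?thesis by (simp only:)
  qed
  then have "y = p" by (rule pgf_unique)
  have law: "distr ?M (count_space UNIV) (\<lambda>\<omega>. inar_shift \<omega> j) = measure_pmf (source_law p q z j)" for j
  proof (cases j)
    case Init
    then show ?thesis using y \<open>y = p\<close> by (simp add: has_law_def)
  next
    case (Innov t)
    then show ?thesis
      using has_law_source[of p q z "Innov (if t = 0 then 0 else Suc t)"]
      by (simp only: has_law_def source_law.simps inar_shift.simps)
  next
    case (Summand i t)
    then show ?thesis
      using has_law_source[of p q z "Summand i (Suc t)"]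
      by (simp only: has_law_def source_law.simps inar_shift.simps)
  qed
  have shift_eta: "(\<lambda>\<omega>. \<lambda>j\<in>UNIV. inar_shift \<omega> j) = inar_shift"
    by (simp add: restrict_UNIV)
  have "distr ?M ?M inar_shift = distr ?M (PiM UNIV (\<lambda>_. count_space UNIV)) inar_shift"
    by (rule distr_cong[OF refl sets_source refl])
  also have "\<dots> = PiM UNIV (\<lambda>j. distr ?M (count_space UNIV) (\<lambda>\<omega>. inar_shift \<omega> j))"
    using ind indep_vars_iff_distr_eq_PiM'[where I = UNIV and M' = "\<lambda>_. count_space UNIV" and X = "\<lambda>j \<omega>. inar_shift \<omega> j"]
    unfolding shift_eta by (simp add: indep_vars_def)
  also have "\<dots> = ?M"
    by (simp only: law)
  finally show ?thesis .
qed

lemma source_space_shift_funpow_invariant: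
  assumes "\<And>s. s \<in> {0..1} \<Longrightarrow> pgf p s = pgf p (pgf z s) * pgf q s"
  shows "inar_shift ^^ h \<in> source_space p q z \<rightarrow>\<^sub>M source_space p q z"
    and "distr (source_space p q z) (source_space p q z) (inar_shift ^^ h) = source_space p q z"
proof (induction h)
  case 0
  {
    case 1 then show ?case by (simp add: id_def)
  next
    case 2 then show ?case by (simp add: id_def)
  }
next
  case (Suc h)
  {
    case 1 then show ?case
      unfolding funpow.simps by (rule measurable_comp[OF Suc(1) measurable_inar_shift])
  next
    case 2 then show ?case
      using distr_distr[OF measurable_inar_shift[of p q z] Suc(1)] Suc(2) source_space_shift_invariant[OF assms]
      by (simp only: funpow.simps)
  }
qed

lemma shifted_sources:
  "(inar_shift ^^ t) \<omega> (Innov 1) = \<omega> (Innov (Suc t))"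
  "(inar_shift ^^ t) \<omega> (Summand i 0) = \<omega> (Summand i t)"
proof -
  have "(inar_shift ^^ t) \<omega> (Innov (Suc u)) = \<omega> (Innov (Suc (u + t)))"
    "(inar_shift ^^ t) \<omega> (Summand i u) = \<omega> (Summand i (u + t))" for u
    by (induction t arbitrary: u) auto
  from this(1)[of 0] this(2)[of 0] show
    "(inar_shift ^^ t) \<omega> (Innov 1) = \<omega> (Innov (Suc t))"
    "(inar_shift ^^ t) \<omega> (Summand i 0) = \<omega> (Summand i t)" by auto
qed

lemma inar_path_recurrence:
  assumes "t \<ge> 1"
  shows "inar_path t \<omega> = (\<Sum>i = 1..inar_path (t - 1) \<omega>. \<omega> (Summand i (t - 1))) + \<omega> (Innov t)"
  using assms by (cases t) (auto simp: inar_path_def inar_next_def shifted_sources simp del: One_nat_def)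

text \<open>
  If \<open>p\<close> solves the stationarity equation with innovation law \<open>q\<close>, then the path process started from
  \<open>p\<close> is stationary, because \<open>X\<^sub>t\<^sub>+\<^sub>h\<close> is \<open>X\<^sub>t\<close> composed with the measure preserving \<open>h\<close>-fold shift.
\<close>
lemma stationary_inar1_exists:
  assumes "(m, r) \<in> R1_params"
    and inv: "\<And>s. s \<in> {0..1} \<Longrightarrow> pgf p s = pgf p (psi m r s) * pgf q s"
  shows "\<exists>(M :: (inar_source \<Rightarrow> nat) measure) X Z \<epsilon>.
    inar1 M m r X Z \<epsilon> \<and> strictly_stationary M X \<and> (\<forall>t. has_law M (X t) p)"
proof -
  have "(m, r) \<in> R_params"
    using assms(1) by (auto simp: R1_params_def R_params_def)
  then obtain z where z: "\<And>s. s \<in> {0..1} \<Longrightarrow> pgf z s = psi m r s"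
    using psi_is_pgf by blast
  let ?M = "source_space p q z"
  interpret prob_space ?M by (rule prob_space_source)
  have pgf_inv: "pgf p s = pgf p (pgf z s) * pgf q s" if "s \<in> {0..1}" for s
    using inv[OF that] z[OF that] by simp
  note shift = source_space_shift_funpow_invariant[of p z q, OF pgf_inv]
  have coord: "(\<lambda>\<omega>. \<omega> Init) \<in> ?M \<rightarrow>\<^sub>M count_space UNIV"
    using has_law_source[of p q z Init] by (simp add: has_law_def)
  have path_meas: "inar_path t \<in> ?M \<rightarrow>\<^sub>M count_space UNIV" for t
    using measurable_compose[OF shift(1) coord] by (simp add: inar_path_def[abs_def])
  have path_law: "has_law ?M (inar_path t) p" for t
  proof -
    have "distr ?M (count_space UNIV) (inar_path t)
        = distr (distr ?M ?M (inar_shift ^^ t)) (count_space UNIV) (\<lambda>\<omega>. \<omega> Init)"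
      by (simp only: distr_distr[OF coord shift(1)] comp_def inar_path_def[abs_def])
    also have "\<dots> = measure_pmf p"
      using has_law_source[of p q z Init] by (simp only: shift(2) has_law_def source_law.simps)
    finally show ?thesis
      using path_meas by (simp only: has_law_def simp_thms)
  qed
  have "strictly_stationary ?M inar_path"
    unfolding strictly_stationary_def
  proof (intro conjI allI impI path_meas)
    fix J :: "nat set" and h
    have "(\<lambda>\<omega>. \<lambda>t\<in>J. inar_path t \<omega>) \<in> ?M \<rightarrow>\<^sub>M (\<Pi>\<^sub>M t\<in>J. count_space UNIV)"
      by (intro measurable_restrict path_meas)
    from distr_distr[OF this shift(1)[of h]]
    have "distr ?M (\<Pi>\<^sub>M t\<in>J. count_space UNIV) ((\<lambda>\<omega>. \<lambda>t\<in>J. inar_path t \<omega>) \<circ> inar_shift ^^ h)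
      = distr ?M (\<Pi>\<^sub>M t\<in>J. count_space UNIV) (\<lambda>\<omega>. \<lambda>t\<in>J. inar_path t \<omega>)"
      by (simp only: shift(2))
    also have "(\<lambda>\<omega>. \<lambda>t\<in>J. inar_path t \<omega>) \<circ> inar_shift ^^ h = (\<lambda>\<omega>. \<lambda>t\<in>J. inar_path (t + h) \<omega>)"
      by (simp add: fun_eq_iff inar_path_def funpow_add)
    finally show "distr ?M (\<Pi>\<^sub>M t\<in>J. count_space UNIV) (\<lambda>\<omega>. \<lambda>t\<in>J. inar_path (t + h) \<omega>)
      = distr ?M (\<Pi>\<^sub>M t\<in>J. count_space UNIV) (\<lambda>\<omega>. \<lambda>t\<in>J. inar_path t \<omega>)" .
  qed
  moreover have "inar1 ?M m r inar_path (\<lambda>i t \<omega>. \<omega> (Summand i t)) (\<lambda>t \<omega>. \<omega> (Innov t))"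
    unfolding inar1_def
  proof (intro conjI assms(1) allI impI path_meas ballI)
    show "prob_space ?M" by (rule prob_space_source)
    show "\<exists>p'. (\<forall>s\<in>{0..1}. pgf p' s = psi m r s) \<and>
        (\<forall>i\<ge>1. \<forall>t. has_law ?M (\<lambda>\<omega>. \<omega> (Summand i t)) p')"
      using z has_law_source[of p q z "Summand _ _"] by (intro exI[of _ z]) auto
    show "\<exists>q'. \<forall>t\<ge>1. has_law ?M (\<lambda>\<omega>. \<omega> (Innov t)) q'"
      using has_law_source[of p q z "Innov _"] by (intro exI[of _ q]) auto
    have "source_var (inar_path 0) (\<lambda>t \<omega>. \<omega> (Innov t)) (\<lambda>i t \<omega>. \<omega> (Summand i t)) = (\<lambda>j \<omega>. \<omega> j)"
    proof
      fix j
      show "source_var (inar_path 0) (\<lambda>t \<omega>. \<omega> (Innov t)) (\<lambda>i t \<omega>. \<omega> (Summand i t)) j = (\<lambda>\<omega>. \<omega> j)"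
        by (cases j) (simp_all add: inar_path_def[abs_def])
    qed
    then show "indep_vars (\<lambda>_. count_space UNIV)
        (source_var (inar_path 0) (\<lambda>t \<omega>. \<omega> (Innov t)) (\<lambda>i t \<omega>. \<omega> (Summand i t))) inar_sources"
      using indep_vars_subset[OF indep_vars_source subset_UNIV, of inar_sources] by (simp only:)
  qed (rule inar_path_recurrence)
  ultimately show ?thesis
    using path_law by blast
qed

section \<open>Identification of the innovations\<close>

text \<open>
  The converse direction: the marginals at the times 0 and 1 already force the stationarity
  equation.
\<close>
lemma inar1_marginal_pgf:
  assumes "inar1 M m r X Z \<epsilon>" and X: "\<And>t. has_law M (X t) p"
    and \<epsilon>: "has_law M (\<epsilon> 1) q" and s: "s \<in> {0..1}"
  shows "pgf p s = pgf p (psi m r s) * pgf q s"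
proof -
  have M: "prob_space M"
    and ind: "prob_space.indep_vars M (\<lambda>_. count_space UNIV) (source_var (X 0) \<epsilon> Z) inar_sources"
    and step: "\<And>t \<omega>. t \<ge> 1 \<Longrightarrow> \<omega> \<in> space M \<Longrightarrow>
      X t \<omega> = (\<Sum>i = 1..X (t - 1) \<omega>. Z i (t - 1) \<omega>) + \<epsilon> t \<omega>"
    using assms(1) unfolding inar1_def by blast+
  obtain z where z: "pgf z s = psi m r s" "\<And>i t. i \<ge> 1 \<Longrightarrow> has_law M (Z i t) z"
    using assms(1) s unfolding inar1_def by blast
  have "pgf p s = pgf p (pgf z s) * pgf q s"
    using X \<epsilon> z(2) step[of 1] by (intro pgf_inar_step[OF M ind _ _ _ X[of 1] _ s]) auto
  then show ?thesis by (simp add: z)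
qed

text \<open>
  With \<open>u = 1 - s\<close> and \<open>d = r' - m'\<close>, every factor is a quotient of linear functions of \<open>u\<close>:
  \<open>psi m' r' s = (1 + d u) / (1 + r' u)\<close>, and replacing \<open>s\<close> by \<open>psi m r s\<close>, which replaces \<open>u\<close> by
  \<open>m u / (1 + r u)\<close>, gives \<open>(1 + (r + d m) u) / (1 + (r + r' m) u)\<close>. In the quotient of these two
  functions, pairing \<open>1 + d u\<close> with \<open>1 + (r + d m) u\<close> and \<open>1 + (r + r' m) u\<close> with \<open>1 + r' u\<close> leaves
  two factors of the form \<open>psi m\<^sub>1 r\<^sub>1 s\<close> and \<open>psi m\<^sub>2 r' s\<close>.
\<close>
lemma CompNB_stationarity_equation:
  fixes m r m' r' a s :: real
  assumes "(m, r) \<in> R1_params" and m': "0 \<le> m'" "m' \<le> r'"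
    and s: "s \<in> {0..1}"
  defines "m\<^sub>1 \<equiv> r + (r' - m') * (m - 1)" and "r\<^sub>1 \<equiv> r + (r' - m') * m" and "m\<^sub>2 \<equiv> r' * (1 - m) - r"
  shows "psi m' r' s powr a
    = psi m' r' (psi m r s) powr a * (psi m\<^sub>1 r\<^sub>1 s powr a * psi m\<^sub>2 r' s powr a)"
proof -
  have mr: "0 \<le> r" "0 < m" "m < 1"
    using assms(1) by (auto simp: R1_params_def)
  define u d where "u = 1 - s" and "d = r' - m'"
  have u: "u \<ge> 0" and d0: "0 \<le> d" and r'0: "0 \<le> r'"
    using s m' by (auto simp: u_def d_def)
  have pos: "1 + r * u > 0" "1 + d * u > 0" "1 + r' * u > 0"
    "1 + (r + d * m) * u > 0" "1 + (r + r' * m) * u > 0"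
    using mr u d0 r'0 by (auto intro!: add_pos_nonneg mult_nonneg_nonneg add_nonneg_nonneg)
  have thin: "psi m' r' (psi m r s) = (1 + (r + d * m) * u) / (1 + (r + r' * m) * u)"
  proof -
    have "1 - psi m r s = m * u / (1 + r * u)"
      by (simp add: psi_def u_def)
    moreover have "psi m r s \<le> 1"
      using mr u pos by (simp add: psi_def u_def[symmetric])
    ultimately have "psi m' r' (psi m r s)
        = (1 + d * (m * u / (1 + r * u))) / (1 + r' * (m * u / (1 + r * u)))"
      using r'0 by (simp add: psi_eq_fraction d_def)
    also have "\<dots> = ((1 + r * u + d * (m * u)) / (1 + r * u)) / ((1 + r * u + r' * (m * u)) / (1 + r * u))"
      using pos by (simp add: add_divide_distrib)
    also have "\<dots> = (1 + r * u + d * (m * u)) / (1 + r * u + r' * (m * u))"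
      using pos(1) by simp
    also have "\<dots> = (1 + (r + d * m) * u) / (1 + (r + r' * m) * u)"
      by (simp add: algebra_simps)
    finally show ?thesis .
  qed
  have r1: "0 \<le> r + d * m" using mr d0 by auto
  have f0: "psi m' r' s = (1 + d * u) / (1 + r' * u)"
    and f1: "psi m\<^sub>1 r\<^sub>1 s = (1 + d * u) / (1 + (r + d * m) * u)"
    and f2: "psi m\<^sub>2 r' s = (1 + (r + r' * m) * u) / (1 + r' * u)"
    using s r'0 r1 by (simp_all add: psi_eq_fraction u_def[symmetric] m\<^sub>1_def r\<^sub>1_def m\<^sub>2_def
        d_def[symmetric] algebra_simps)
  have "psi m' r' s = psi m' r' (psi m r s) * (psi m\<^sub>1 r\<^sub>1 s * psi m\<^sub>2 r' s)"
    unfolding thin f0 f1 f2 using pos by simp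
  moreover have "0 \<le> psi m' r' (psi m r s)" "0 \<le> psi m\<^sub>1 r\<^sub>1 s" "0 \<le> psi m\<^sub>2 r' s"
    unfolding thin f1 f2 using pos by auto
  ultimately show ?thesis by (simp add: powr_mult)
qed

theorem proposition3p8:
  fixes m r m' r' a m\<^sub>1 r\<^sub>1 m\<^sub>2 r\<^sub>2 :: real
  assumes "(m, r) \<in> R1_params" and "a > 0"
    and "(m', r') \<in> R_params"
    and "0 \<le> r' - m'" and "r' - m' < r / (1 - m)"
    and "r' \<ge> r / (1 - m)"
    and "(m\<^sub>1, r\<^sub>1) = (r + (r' - m') * (m - 1), r + (r' - m') * m)"
    and "(m\<^sub>2, r\<^sub>2) = (r' * (1 - m) - r, r')"
  shows
    "(\<exists>(M :: (inar_source \<Rightarrow> nat) measure) X Z \<epsilon>.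
        inar1 M m r X Z \<epsilon> \<and> strictly_stationary M X \<and>
        (\<exists>p. CompNB m' r' a p \<and> (\<forall>t. has_law M (X t) p))) \<and>
     (\<forall>(M :: 'w measure) X Z \<epsilon>.
        inar1 M m r X Z \<epsilon> \<and> strictly_stationary M X \<and>
        (\<exists>p. CompNB m' r' a p \<and> (\<forall>t. has_law M (X t) p)) \<longrightarrow>
        (\<exists>p\<^sub>1 p\<^sub>2. CompNB m\<^sub>1 r\<^sub>1 a p\<^sub>1 \<and> CompNB m\<^sub>2 r\<^sub>2 a p\<^sub>2 \<and>
           (\<forall>t\<ge>1. has_law M (\<epsilon> t) (convolution_pmf p\<^sub>1 p\<^sub>2))))"
proof -
  have mr: "0 \<le> r" "0 < m" "m < 1" and m': "0 \<le> m'" "m' \<le> r'"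
    using assms(1,3,4) by (auto simp: R1_params_def R_params_def)
  have par: "(r' - m') * (1 - m) \<le> r" "r \<le> r' * (1 - m)"
    using assms(5,6) mr by (auto simp: field_simps)
  have m1: "m\<^sub>1 = r + (r' - m') * (m - 1)" and r1: "r\<^sub>1 = r + (r' - m') * m"
    and m2: "m\<^sub>2 = r' * (1 - m) - r" and r2: "r\<^sub>2 = r'"
    using assms(7,8) by auto
  have "0 \<le> m\<^sub>1" "m\<^sub>1 \<le> r\<^sub>1" "0 \<le> m\<^sub>2" "m\<^sub>2 \<le> r\<^sub>2"
  proof -
    show "0 \<le> m\<^sub>1" "0 \<le> m\<^sub>2"
      using par by (auto simp: m1 m2 algebra_simps)
    show "m\<^sub>1 \<le> r\<^sub>1"
      using m' by (simp add: m1 r1 algebra_simps)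
    have "0 \<le> r' * m" using m' mr by auto
    then show "m\<^sub>2 \<le> r\<^sub>2"
      using mr by (simp add: m2 r2 algebra_simps)
  qed
  then obtain p\<^sub>1 p\<^sub>2 where p12: "CompNB m\<^sub>1 r\<^sub>1 a p\<^sub>1" "CompNB m\<^sub>2 r\<^sub>2 a p\<^sub>2"
    using CompNB_exists assms(2) by metis
  have innov: "psi m' r' s powr a
      = psi m' r' (psi m r s) powr a * pgf (convolution_pmf p\<^sub>1 p\<^sub>2) s" if s: "s \<in> {0..1}" for s
    using CompNB_stationarity_equation[OF assms(1) m' s, of a] p12 s
    by (simp add: pgf_convolution CompNB_def m1 r1 m2 r2)
  have psi_range: "psi m r s \<in> {0..1}" if s: "s \<in> {0..1}" for s
  proof -
    have "(m, r) \<in> R_params" using mr by (auto simp: R_params_def)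
    then obtain z where "pgf z s = psi m r s" using psi_is_pgf s by metis
    then show ?thesis using pgf_nonneg[OF s, of z] pgf_le_1[OF s, of z] by simp
  qed
  have marginal: "pgf p s = pgf p (psi m r s) * pgf (convolution_pmf p\<^sub>1 p\<^sub>2) s"
    if "CompNB m' r' a p" "s \<in> {0..1}" for p s
    using that(1) innov[OF that(2)] psi_range[OF that(2)] that(2) by (simp add: CompNB_def)
  show ?thesis
  proof (intro conjI allI impI)
    obtain p where p: "CompNB m' r' a p"
      using CompNB_exists[OF m' assms(2)] .
    show "\<exists>(M :: (inar_source \<Rightarrow> nat) measure) X Z \<epsilon>.
        inar1 M m r X Z \<epsilon> \<and> strictly_stationary M X \<and>
        (\<exists>p. CompNB m' r' a p \<and> (\<forall>t. has_law M (X t) p))"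
      using stationary_inar1_exists[OF assms(1) marginal[OF p]] p by blast
  next
    fix M :: "'w measure" and X Z \<epsilon>
    assume asm: "inar1 M m r X Z \<epsilon> \<and> strictly_stationary M X \<and>
        (\<exists>p. CompNB m' r' a p \<and> (\<forall>t. has_law M (X t) p))"
    then obtain p q where inar: "inar1 M m r X Z \<epsilon>" and p: "CompNB m' r' a p"
      and X: "\<And>t. has_law M (X t) p" and q: "\<And>t. t \<ge> 1 \<Longrightarrow> has_law M (\<epsilon> t) q"
      unfolding inar1_def by blast
    \<comment> \<open>Both innovation laws solve the stationarity equation, whose other factor is positive.\<close>
    have "pgf q s = pgf (convolution_pmf p\<^sub>1 p\<^sub>2) s" if s: "s \<in> {0..1}" for s
    proof -
      have "psi m r s \<in> {0..1}" using psi_range[OF s] .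
      then have "pgf p (psi m r s) = psi m' r' (psi m r s) powr a"
        using p by (simp add: CompNB_def)
      moreover have "psi m' r' (psi m r s) > 0"
        using m' psi_range[OF s] by (intro psi_pos) auto
      moreover have "pgf p (psi m r s) * pgf q s
          = pgf p (psi m r s) * pgf (convolution_pmf p\<^sub>1 p\<^sub>2) s"
        using inar1_marginal_pgf[OF inar X q[OF order_refl] s, symmetric] marginal[OF p s] by (rule trans)
      ultimately show ?thesis by simp
    qed
    then have "q = convolution_pmf p\<^sub>1 p\<^sub>2" by (rule pgf_unique)
    then show "\<exists>p\<^sub>1 p\<^sub>2. CompNB m\<^sub>1 r\<^sub>1 a p\<^sub>1 \<and> CompNB m\<^sub>2 r\<^sub>2 a p\<^sub>2 \<and>
           (\<forall>t\<ge>1. has_law M (\<epsilon> t) (convolution_pmf p\<^sub>1 p\<^sub>2))"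
      using p12 q by blast
  qed
qed

end
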